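(* Let $\mathfrak{S}_n(q)=\sum_{k=0}^n\binom{n}{k}^2k!\,q^k$ for $n\ge 0$. The sequence $(\mathfrak{S}_n(q))_{n\ge 0}$ is $q$-Stieltjes moment; that is, every minor of the infinite Hankel matrix $[\mathfrak{S}_{i+j}(q)]_{i,j\ge 0}$ is a polynomial in $q$ with nonnegative coefficients.
   Context: $\mathfrak{S}_n(q)$ is the rook polynomial of a square of side $n$. *)

theory Defs
  imports "HOL-Computational_Algebra.Polynomial" "Jordan_Normal_Form.Determinant"
begin

definition rook_square :: "nat \<Rightarrow> real poly" where
  "rook_square n = (\<Sum>k=0..n. monom (of_nat ((n choose k)\<^sup>2 * fact k)) k)"

(* Infinite matrices are functions on pairs of row and column indices. *)

definition hankel :: "(nat \<Rightarrow> 'a) \<Rightarrow> nat \<Rightarrow> nat \<Rightarrow> 'a" where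
  "hankel a i j = a (i + j)"

(* The minor of M in rows r 0, ..., r (m-1) and columns c 0, ..., c (m-1); a genuine minor
   only when r and c are strictly increasing below m, otherwise its sign may differ. *)
definition minor :: "(nat \<Rightarrow> nat \<Rightarrow> 'a::comm_ring_1) \<Rightarrow> nat \<Rightarrow> (nat \<Rightarrow> nat) \<Rightarrow> (nat \<Rightarrow> nat) \<Rightarrow> 'a" where
  "minor M m r c = det (mat m m (\<lambda>(i, j). M (r i) (c j)))"

definition q_nonneg :: "real poly \<Rightarrow> bool" where
  "q_nonneg p \<longleftrightarrow> (\<forall>k. coeff p k \<ge> 0)"

(* The case m = 0 is included; it is the empty minor 1. *)
definition q_totally_positive :: "(nat \<Rightarrow> nat \<Rightarrow> real poly) \<Rightarrow> bool" where
  "q_totally_positive M \<longleftrightarrow>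
     (\<forall>m r c. strict_mono_on {..<m} r \<longrightarrow> strict_mono_on {..<m} c \<longrightarrow> q_nonneg (minor M m r c))"

definition q_stieltjes_moment :: "(nat \<Rightarrow> real poly) \<Rightarrow> bool" where
  "q_stieltjes_moment a \<longleftrightarrow> q_totally_positive (hankel a)"

end

theory Submission
  imports Defs
begin

text \<open>
  Write \<open>S n\<close> for the rook polynomial of the square. Reversing the defining sum turns it into
  a Laguerre polynomial: \<open>S n = p n (1)\<close> with
  \<open>p n (x) = (\<Sum>k\<le>n. (n choose k) * n! / k! * q^(n-k) * x^k)\<close>. These polynomials satisfy
  \<open>p (n+1) = T (p n)\<close> for the operator \<open>T = (1 + q D) x (1 + q D)\<close>, where \<open>D = d/dx\<close> and \<open>x\<close>
  stands for multiplication by \<open>x\<close>. After the substitution \<open>x = y + 1\<close> the value at \<open>x = 1\<close> becomes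
  the constant coefficient in \<open>y\<close>, and \<open>T\<close> becomes \<open>(1 + q D) (y + 1) (1 + q D)\<close>. In the basis of
  powers of \<open>y\<close> this is the matrix \<open>P = A X A\<close>, with \<open>A\<close> the matrix of \<open>1 + q D\<close> and \<open>X\<close> the matrix
  of multiplication by \<open>y + 1\<close>; polynomials are row vectors, so matrices act on the right. Hence
  \<open>S n\<close> is the entry of \<open>P^n\<close> at \<open>(0, 0)\<close> (lemma \<open>rook_square_eq_P_power\<close>).

  Both \<open>A\<close> and \<open>X\<close> are bidiagonal with entries that have nonnegative coefficients. Multiplying by
  such a matrix replaces each row (or column) by a nonnegative combination of two neighbours, and
  this preserves total positivity: expand a minor of the new matrix by multilinearity; every term
  selects rows of the old matrix in weakly increasing order, so it is a minor or has two equal rows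
  (lemma \<open>q_totally_positive_mix_rows\<close>). The Cauchy--Binet formula is thereby avoided.

  It remains to reach the Hankel matrix from the unit matrix by such steps. Let \<open>e k\<close> be the unit
  row vectors. The Hankel matrix is \<open>O O'\<close>, where row \<open>i\<close> of \<open>O\<close> is \<open>e 0 P^i\<close> and column \<open>j\<close> of
  \<open>O'\<close> is the first column of \<open>P^j\<close>. The product is built up from the unit matrix, one
  power of \<open>P\<close> at a time: first \<open>O\<close> by row operations (\<open>left_stage\<close>), then the product \<open>O O'\<close> by
  column operations (\<open>right_stage\<close>). A single minor sees only finitely many rows and columns, so
  finitely many stages suffice for it.
\<close>

section \<open>Polynomials with nonnegative coefficients\<close>

lemma q_nonneg_0: "q_nonneg 0" and q_nonneg_1: "q_nonneg 1"
  by (auto simp: q_nonneg_def coeff_1)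

lemma q_nonneg_add: "q_nonneg p \<Longrightarrow> q_nonneg s \<Longrightarrow> q_nonneg (p + s)"
  by (simp add: q_nonneg_def)

lemma q_nonneg_mult: "q_nonneg p \<Longrightarrow> q_nonneg s \<Longrightarrow> q_nonneg (p * s)"
  by (auto simp: q_nonneg_def coeff_mult intro!: sum_nonneg)

definition q_var :: "real poly" where
  "q_var = monom 1 1"

lemma q_nonneg_of_nat_q_var: "q_nonneg (of_nat n * q_var)"
  by (auto simp: q_nonneg_def q_var_def of_nat_poly coeff_monom)

section \<open>Operations preserving total positivity\<close>

lemma minor_transpose: "minor (\<lambda>i j. M j i) m r c = minor M m c r"
proof -
  have "mat m m (\<lambda>(i, j). M (c j) (r i)) = transpose_mat (mat m m (\<lambda>(i, j). M (c i) (r j)))"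
    by (intro eq_matI) auto
  then show ?thesis
    unfolding minor_def by (metis det_transpose mat_carrier)
qed

lemma q_totally_positive_transpose:
  "q_totally_positive (\<lambda>i j. M j i) \<longleftrightarrow> q_totally_positive M"
  unfolding q_totally_positive_def minor_transpose[of M] by blast

lemma minor_cong:
  assumes "\<And>i j. i < m \<Longrightarrow> j < m \<Longrightarrow> M (r i) (c j) = N (r' i) (c' j)"
  shows "minor M m r c = minor N m r' c'"
  unfolding minor_def by (rule arg_cong[of _ _ det], rule eq_matI) (use assms in auto)

lemma minor_zero_row:
  assumes "k < m" "\<And>j. j < m \<Longrightarrow> M (r k) (c j) = 0"
  shows "minor M m r c = 0"
proof -
  have "det (mat m m (\<lambda>(i, j). M (r i) (c j))) = 0"
    by (subst laplace_expansion_row[OF mat_carrier \<open>k < m\<close>]) (use assms in auto)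
  then show ?thesis by (simp add: minor_def)
qed

text \<open>
  Linearity of the determinant in one row. The cofactors along row \<open>k\<close> do not involve that row,
  so the three Laplace expansions share them.
\<close>

lemma minor_row_combination:
  assumes k: "k < m"
    and comb: "\<And>j. j < m \<Longrightarrow> A k (c j) = a * B k (c j) + b * C k (c j)"
    and B: "\<And>i j. i < m \<Longrightarrow> i \<noteq> k \<Longrightarrow> B i (c j) = A i (c j)"
    and C: "\<And>i j. i < m \<Longrightarrow> i \<noteq> k \<Longrightarrow> C i (c j) = A i (c j)"
  shows "minor A m id c = a * minor B m id c + b * minor C m id c"
proof -
  let ?M = "\<lambda>A. mat m m (\<lambda>(i, j). A i (c j))"
  have del: "mat_delete (?M D) k j = mat_delete (?M A) k j"
    if "\<And>i j. i < m \<Longrightarrow> i \<noteq> k \<Longrightarrow> D i (c j) = A i (c j)" for D j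
    by (rule eq_matI) (use that in \<open>auto simp: mat_delete_def\<close>)
  have exp: "minor D m id c = (\<Sum>j<m. D k (c j) * cofactor (?M A) k j)"
    if "\<And>i j. i < m \<Longrightarrow> i \<noteq> k \<Longrightarrow> D i (c j) = A i (c j)" for D
  proof -
    have "minor D m id c = (\<Sum>j<m. ?M D $$ (k, j) * cofactor (?M D) k j)"
      unfolding minor_def id_apply by (rule laplace_expansion_row[OF mat_carrier k])
    also have "\<dots> = (\<Sum>j<m. D k (c j) * cofactor (?M A) k j)"
      using k by (intro sum.cong) (auto simp: cofactor_def del[OF that])
    finally show ?thesis .
  qed
  have "minor A m id c = (\<Sum>j<m. A k (c j) * cofactor (?M A) k j)"
    by (rule exp) simp
  moreover have "minor B m id c = (\<Sum>j<m. B k (c j) * cofactor (?M A) k j)"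
    by (rule exp) (rule B)
  moreover have "minor C m id c = (\<Sum>j<m. C k (c j) * cofactor (?M A) k j)"
    by (rule exp) (rule C)
  ultimately show ?thesis
    by (simp add: comb sum_distrib_left distrib_right mult.assoc sum.distrib)
qed

text \<open>
  The terms of a multilinear expansion select rows that need not be distinct; a repeated row makes
  the determinant vanish, so weak monotonicity suffices.
\<close>

lemma minor_mono_nonneg:
  assumes M: "q_totally_positive M" and c: "strict_mono_on {..<m} c"
    and d: "mono_on {..<m} d"
  shows "q_nonneg (minor M m d c)"
proof (cases "inj_on d {..<m}")
  case True
  then have "strict_mono_on {..<m} d"
    using d by (auto simp: strict_mono_on_def mono_on_def inj_on_def order.strict_iff_order)
  then show ?thesis
    using M c by (auto simp: q_totally_positive_def)
next
  case False
  then obtain i j where ij: "i < m" "j < m" "i \<noteq> j" "d i = d j"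
    by (auto simp: inj_on_def)
  then have "minor M m d c = 0"
    unfolding minor_def by (intro det_identical_rows[OF mat_carrier \<open>i \<noteq> j\<close> ij(1,2)]) auto
  then show ?thesis
    by (simp add: q_nonneg_0)
qed

text \<open>
  Each new row mixes two old ones, and the condition on \<open>u\<close> and \<open>v\<close> says that whichever old row is
  picked for each new row, the order of the rows is weakly respected. The bidiagonal operations
  are the instances where \<open>u\<close> is the identity and \<open>v\<close> is the predecessor or the successor.
\<close>

lemma q_totally_positive_mix_rows:
  assumes M: "q_totally_positive M"
    and a: "\<And>i. q_nonneg (a i)" and b: "\<And>i. q_nonneg (b i)"
    and uv: "\<And>i k. i < k \<Longrightarrow> max (u i) (v i) \<le> min (u k) (v k)"
  shows "q_totally_positive (\<lambda>i j. a i * M (u i) j + b i * M (v i) j)"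
    (is "q_totally_positive ?N")
  unfolding q_totally_positive_def
proof (intro allI impI)
  fix m :: nat and r c :: "nat \<Rightarrow> nat"
  assume r: "strict_mono_on {..<m} r" and c: "strict_mono_on {..<m} c"
  let ?R = "\<lambda>p d i j. if i < p then ?N (r i) j else M (d i) j"
  \<comment> \<open>The first \<open>p\<close> rows are new rows, the others are old rows already selected by \<open>d\<close>; each
    induction step splits the last new row into its two old constituents.\<close>
  have main: "q_nonneg (minor (?R p d) m id c)"
    if "p \<le> m" "\<And>i. i < m \<Longrightarrow> d i \<in> {u (r i), v (r i)}" for p d
    using that
  proof (induction p arbitrary: d)
    case 0
    have "mono_on {..<m} d"
    proof (rule mono_onI)
      fix i k assume ik: "i \<in> {..<m}" "k \<in> {..<m}" "i \<le> k"
      show "d i \<le> d k"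
      proof (cases "i = k")
        case False
        then have "r i < r k"
          using ik r by (auto simp: strict_mono_on_def)
        then show ?thesis
          using uv[of "r i" "r k"] 0(2)[of i] 0(2)[of k] ik by auto
      qed simp
    qed
    then have "q_nonneg (minor M m d c)"
      by (rule minor_mono_nonneg[OF M c])
    also have "minor M m d c = minor (?R 0 d) m id c"
      by (rule minor_cong) simp
    finally show ?case .
  next
    case (Suc p)
    have "minor (?R (Suc p) d) m id c =
        a (r p) * minor (?R p (d(p := u (r p)))) m id c +
        b (r p) * minor (?R p (d(p := v (r p)))) m id c"
      by (rule minor_row_combination[of p]) (use Suc.prems in auto)
    moreover have "q_nonneg (minor (?R p (d(p := x))) m id c)" if "x \<in> {u (r p), v (r p)}" for x
      using that Suc.prems by (intro Suc.IH) auto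
    ultimately show ?case
      by (simp only: insert_iff simp_thms q_nonneg_add q_nonneg_mult a b)
  qed
  have "q_nonneg (minor (?R m (u \<circ> r)) m id c)"
    by (rule main) auto
  also have "minor (?R m (u \<circ> r)) m id c = minor ?N m r c"
    by (rule minor_cong) simp
  finally show "q_nonneg (minor ?N m r c)" .
qed

lemma q_totally_positive_add_previous_row:
  assumes "q_totally_positive M" and "\<And>i. q_nonneg (a i)" and "\<And>i. q_nonneg (b i)"
  shows "q_totally_positive (\<lambda>i j. a i * M i j + b i * M (i - 1) j)"
  by (rule q_totally_positive_mix_rows) (use assms in auto)

lemma q_totally_positive_add_previous_column:
  assumes M: "q_totally_positive M" and "\<And>j. q_nonneg (a j)" and "\<And>j. q_nonneg (b j)"
  shows "q_totally_positive (\<lambda>i j. a j * M i j + b j * M i (j - 1))"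
proof -
  have "q_totally_positive (\<lambda>i j. M j i)"
    using M by (rule q_totally_positive_transpose[THEN iffD2])
  then have "q_totally_positive (\<lambda>j i. a j * M i j + b j * M i (j - 1))"
    by (rule q_totally_positive_mix_rows) (use assms in auto)
  then show ?thesis
    by (rule q_totally_positive_transpose[THEN iffD1])
qed

lemma q_totally_positive_add_next_column:
  assumes M: "q_totally_positive M" and "\<And>j. q_nonneg (a j)" and "\<And>j. q_nonneg (b j)"
  shows "q_totally_positive (\<lambda>i j. a j * M i j + b j * M i (Suc j))"
proof -
  have "q_totally_positive (\<lambda>i j. M j i)"
    using M by (rule q_totally_positive_transpose[THEN iffD2])
  then have "q_totally_positive (\<lambda>j i. a j * M i j + b j * M i (Suc j))"
    by (rule q_totally_positive_mix_rows) (use assms in auto)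
  then show ?thesis
    by (rule q_totally_positive_transpose[THEN iffD1])
qed

definition unit_matrix :: "nat \<Rightarrow> nat \<Rightarrow> real poly" where
  "unit_matrix i j = of_bool (i = j)"

text \<open>
  A minor of the unit matrix is 1 if it selects the same rows as columns; otherwise some selected
  row has its only nonzero entry outside the selected columns.
\<close>

lemma q_totally_positive_unit_matrix: "q_totally_positive unit_matrix"
  unfolding q_totally_positive_def
proof (intro allI impI)
  fix m :: nat and r c :: "nat \<Rightarrow> nat"
  assume r: "strict_mono_on {..<m} r" and c: "strict_mono_on {..<m} c"
  have inj: "inj_on r {..<m}" "inj_on c {..<m}"
    using r c by (auto intro: strict_mono_on_imp_inj_on)
  show "q_nonneg (minor unit_matrix m r c)"
  proof (cases "r ` {..<m} \<subseteq> c ` {..<m}")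
    case True
    then have img: "r ` {..<m} = c ` {..<m}"
      using inj by (intro card_subset_eq) (auto simp: card_image)
    have "sorted (map f [0..<m])" if "strict_mono_on {..<m} f" for f :: "nat \<Rightarrow> nat"
      using that by (auto simp: sorted_iff_nth_mono_less strict_mono_on_def intro!: less_imp_le)
    then have "map r [0..<m] = map c [0..<m]"
      using r c inj img
      by (intro sorted_distinct_set_unique) (auto simp: distinct_map atLeast0LessThan)
    then have eq: "r i = c i" if "i < m" for i
      using that by simp
    have "mat m m (\<lambda>(i, j). unit_matrix (r i) (c j)) = 1\<^sub>m m"
      using inj(2) by (intro eq_matI) (auto simp: eq unit_matrix_def inj_on_def)
    then show ?thesis
      by (simp add: minor_def q_nonneg_1)
  next
    case False
    then obtain k where "k < m" "r k \<notin> c ` {..<m}"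
      by auto
    then have "minor unit_matrix m r c = 0"
      by (intro minor_zero_row[of k]) (auto simp: unit_matrix_def)
    then show ?thesis
      by (simp add: q_nonneg_0)
  qed
qed

section \<open>The matrix whose powers generate the sequence\<close>

text \<open>
  These four are the products \<open>M A\<close>, \<open>M X\<close>, \<open>A M\<close> and \<open>X M\<close>. The matrix \<open>A\<close> of \<open>1 + q D\<close> has
  entries \<open>1\<close> at \<open>(i, i)\<close> and \<open>i q\<close> at \<open>(i, i-1)\<close>; the matrix \<open>X\<close> of multiplication by \<open>y + 1\<close>
  has entries \<open>1\<close> at \<open>(i, i)\<close> and at \<open>(i, i+1)\<close>. Writing the products as operations on functions
  avoids infinite sums.
\<close>

definition right_A :: "(nat \<Rightarrow> nat \<Rightarrow> real poly) \<Rightarrow> nat \<Rightarrow> nat \<Rightarrow> real poly" where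
  "right_A M i j = M i j + of_nat (Suc j) * q_var * M i (Suc j)"

definition right_X :: "(nat \<Rightarrow> nat \<Rightarrow> real poly) \<Rightarrow> nat \<Rightarrow> nat \<Rightarrow> real poly" where
  "right_X M i j = M i j + of_bool (j > 0) * M i (j - 1)"

definition left_A :: "(nat \<Rightarrow> nat \<Rightarrow> real poly) \<Rightarrow> nat \<Rightarrow> nat \<Rightarrow> real poly" where
  "left_A M i j = M i j + of_nat i * q_var * M (i - 1) j"

definition left_X :: "(nat \<Rightarrow> nat \<Rightarrow> real poly) \<Rightarrow> nat \<Rightarrow> nat \<Rightarrow> real poly" where
  "left_X M i j = M i j + M (Suc i) j"

primrec P_power :: "nat \<Rightarrow> nat \<Rightarrow> nat \<Rightarrow> real poly" where
  "P_power 0 = unit_matrix"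
| "P_power (Suc t) = right_A (right_X (right_A (P_power t)))"

lemma left_right_commute:
  "left_A (right_A M) = right_A (left_A M)"
  "left_A (right_X M) = right_X (left_A M)"
  "left_X (right_A M) = right_A (left_X M)"
  "left_X (right_X M) = right_X (left_X M)"
  by (intro ext; simp add: left_A_def left_X_def right_A_def right_X_def algebra_simps)+

lemma left_right_unit_matrix:
  "left_A unit_matrix = right_A unit_matrix"
  "left_X unit_matrix = right_X unit_matrix"
  by (intro ext; auto simp: left_A_def left_X_def right_A_def right_X_def unit_matrix_def)+

text \<open>
  Powers of \<open>P\<close> are defined by multiplication on the right, but row operations need \<open>P\<close> on the
  left. The two agree since left and right products commute and agree on the unit matrix.
\<close>

lemma P_power_Suc_left: "P_power (Suc t) = left_A (left_X (left_A (P_power t)))"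
proof (induction t)
  case 0
  show ?case
    by (simp add: left_right_unit_matrix left_right_commute)
next
  case (Suc t)
  have "P_power (Suc (Suc t)) = right_A (right_X (right_A (left_A (left_X (left_A (P_power t))))))"
    by (subst P_power.simps(2)) (simp only: Suc.IH)
  then show ?case
    by (simp add: left_right_commute)
qed

section \<open>Laguerre polynomials and the rook polynomials of squares\<close>

text \<open>
  The coefficient of \<open>x^k\<close> in \<open>p n (x)\<close>, a rescaled Laguerre polynomial. For \<open>k > n\<close> the binomial
  coefficient makes it 0, so the truncated exponent does no harm.
\<close>

definition laguerre_coeff :: "nat \<Rightarrow> nat \<Rightarrow> real poly" where
  "laguerre_coeff n k = monom (of_nat (n choose k) * fact n / fact k) (n - k)"

lemma laguerre_coeff_eq_0: "n < k \<Longrightarrow> laguerre_coeff n k = 0"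
  by (simp add: laguerre_coeff_def)

lemma Suc_times_choose_Suc: "(real k + 1) * real (n choose Suc k) = (real n - real k) * real (n choose k)"
proof (cases "k \<le> n")
  case True
  have "Suc k * (n choose Suc k) = (n - k) * (n choose k)"
    by (metis binomial_absorb_comp binomial_absorption)
  then have "real (Suc k) * real (n choose Suc k) = real (n - k) * real (n choose k)"
    by (metis of_nat_mult)
  then show ?thesis
    using True by (simp add: of_nat_diff add.commute)
qed (simp add: binomial_eq_0)

text \<open>
  The recurrence for the numerical parts of the coefficients. Multiplied by \<open>k! / n!\<close> it becomes a
  relation between three consecutive binomial coefficients, which follows from
  \<open>(k+1) * (n choose (k+1)) = (n-k) * (n choose k)\<close>.
\<close>

lemma laguerre_number_Suc:
  fixes c :: "nat \<Rightarrow> nat \<Rightarrow> real"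
  defines "c \<equiv> \<lambda>n k. of_nat (n choose k) * fact n / fact k"
  shows "c (Suc n) k = of_bool (k > 0) * c n (k - 1) + real (2 * k + 1) * c n k
           + real ((Suc k)\<^sup>2) * c n (Suc k)"
proof (cases k)
  case 0
  show ?thesis
    by (simp add: 0 c_def algebra_simps)
next
  case (Suc l)
  define x y z where "x = real (n choose l)" and "y = real (n choose k)"
    and "z = real (n choose Suc k)"
  have xy: "(real l + 1) * y = (real n - real l) * x"
    and yz: "(real l + 2) * z = (real n - real l - 1) * y"
    using Suc_times_choose_Suc[of l n] Suc_times_choose_Suc[of k n]
    by (simp_all add: x_def y_def z_def Suc algebra_simps)
  have "(real n + 1) * (x + y) = (real l + 1) * x + (2 * real l + 3) * y + (real l + 2) * z"
    unfolding yz using xy by (simp add: algebra_simps)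
  then have "(real n + 1) * (x + y) * fact n / fact k =
      ((real l + 1) * x + (2 * real l + 3) * y + (real l + 2) * z) * fact n / fact k"
    by simp
  moreover have "c (Suc n) k = (real n + 1) * (x + y) * fact n / fact k"
    by (simp add: c_def x_def y_def Suc algebra_simps)
  moreover have "c n (k - 1) = (real l + 1) * x * fact n / fact k"
    by (simp add: c_def x_def Suc divide_simps)
  moreover have "real ((Suc k)\<^sup>2) * c n (Suc k) = (real l + 2) * z * fact n / fact k"
    by (simp add: c_def z_def Suc divide_simps power2_eq_square) (simp add: algebra_simps)
  moreover have "real (2 * k + 1) * c n k = (2 * real l + 3) * y * fact n / fact k"
    by (simp add: c_def y_def Suc)
  ultimately show ?thesis
    using Suc by (simp add: algebra_simps add_divide_distrib)
qed

text \<open>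
  This is \<open>p (n+1) = T (p n)\<close> read off coefficientwise, as
  \<open>T (x^k) = x^(k+1) + (2k+1) q x^k + k^2 q^2 x^(k-1)\<close>.
\<close>

lemma laguerre_coeff_Suc:
  "laguerre_coeff (Suc n) k =
     of_bool (k > 0) * laguerre_coeff n (k - 1) + of_nat (2 * k + 1) * q_var * laguerre_coeff n k
     + of_nat ((Suc k)\<^sup>2) * q_var\<^sup>2 * laguerre_coeff n (Suc k)"
proof -
  define c :: "nat \<Rightarrow> nat \<Rightarrow> real" where "c = (\<lambda>n k. of_nat (n choose k) * fact n / fact k)"
  have c0: "c n k = 0" if "n < k" for k
    using that by (simp add: c_def)
  have L: "laguerre_coeff n k = monom (c n k) (n - k)" for n k
    by (simp add: laguerre_coeff_def c_def)
  have 1: "of_bool (k > 0) * laguerre_coeff n (k - 1) =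
      monom (of_bool (k > 0) * c n (k - 1)) (Suc n - k)"
    by (cases k) (simp_all add: L)
  have 2: "of_nat (2 * k + 1) * q_var * laguerre_coeff n k =
      monom (real (2 * k + 1) * c n k) (Suc n - k)"
    by (cases "k \<le> n") (simp_all add: L c0 q_var_def mult_monom of_nat_monom Suc_diff_le
        del: of_nat_add of_nat_mult of_nat_Suc)
  have 3: "of_nat ((Suc k)\<^sup>2) * q_var\<^sup>2 * laguerre_coeff n (Suc k) =
      monom (real ((Suc k)\<^sup>2) * c n (Suc k)) (Suc n - k)"
  proof (cases "Suc k \<le> n")
    case True
    then have "Suc (Suc (n - Suc k)) = Suc n - k"
      by simp
    then show ?thesis
      by (simp add: L q_var_def mult_monom of_nat_monom power2_eq_square
          del: of_nat_add of_nat_mult of_nat_Suc)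
  qed (simp add: L c0)
  show ?thesis
    unfolding 1 2 3 add_monom unfolding L c_def by (simp only: laguerre_number_Suc)
qed

text \<open>
  Row \<open>k\<close> lists the coefficients of \<open>(y + 1)^k\<close>, so this matrix is the substitution \<open>x = y + 1\<close>.
\<close>

definition pascal :: "nat \<Rightarrow> nat \<Rightarrow> real poly" where
  "pascal k j = of_nat (k choose j)"

text \<open>
  Differentiation commutes with the shift \<open>x = y + 1\<close>, and multiplication by \<open>y + 1\<close> is
  multiplication by \<open>x\<close>; the next two lemmas say this for \<open>(y + 1)^k\<close>.
\<close>

lemma right_A_pascal: "right_A pascal = left_A pascal"
proof (intro ext)
  fix k j
  have "Suc j * (k choose Suc j) = k * (k - 1 choose j)"
    by (cases k) (simp_all only: Suc_times_binomial binomial_0_Suc mult_0_right mult_0 diff_Suc_1)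
  then have "of_nat (Suc j) * (of_nat (k choose Suc j) :: real poly) = of_nat k * of_nat (k - 1 choose j)"
    by (metis of_nat_mult)
  then show "right_A pascal k j = left_A pascal k j"
    unfolding right_A_def left_A_def pascal_def
    by (simp only: mult.assoc mult.left_commute[of _ q_var])
qed

lemma right_X_pascal: "right_X pascal k = pascal (Suc k)"
proof
  show "right_X pascal k j = pascal (Suc k) j" for j
    by (cases j) (simp_all add: right_X_def pascal_def)
qed

text \<open>
  Multiplication on the right acts on each row separately and linearly.
\<close>

lemma right_A_sum:
  assumes "M i = (\<lambda>j. \<Sum>k\<in>K. c k * N k j)"
  shows "right_A M i = (\<lambda>j. \<Sum>k\<in>K. c k * right_A N k j)"
  by (rule ext) (simp add: right_A_def assms sum_distrib_left sum.distrib algebra_simps)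

lemma right_X_sum:
  assumes "M i = (\<lambda>j. \<Sum>k\<in>K. c k * N k j)"
  shows "right_X M i = (\<lambda>j. \<Sum>k\<in>K. c k * right_X N k j)"
  by (rule ext) (simp add: right_X_def assms sum_distrib_left sum.distrib algebra_simps)

text \<open>
  The action of \<open>T\<close> on \<open>x^k\<close>, in the variable \<open>y\<close>.
\<close>

lemma P_action_on_pascal:
  "right_A (right_X (right_A pascal)) k j =
     pascal (Suc k) j + of_nat (2 * k + 1) * q_var * pascal k j
     + of_nat (k\<^sup>2) * q_var\<^sup>2 * pascal (k - 1) j"
proof -
  have "right_A (right_X pascal) = (\<lambda>k. left_A pascal (Suc k))"
    by (intro ext) (simp add: right_A_def right_X_pascal flip: right_A_pascal)
  then have "right_A (right_X (right_A pascal)) = left_A (\<lambda>k. left_A pascal (Suc k))"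
    by (simp add: right_A_pascal flip: left_right_commute)
  then show ?thesis
    by (cases k) (simp_all add: left_A_def power2_eq_square algebra_simps)
qed

text \<open>
  Row 0 of \<open>P^n\<close> is \<open>e 0 P^n\<close>, that is, \<open>T\<close> applied \<open>n\<close> times to the constant 1, written in powers
  of \<open>y\<close>: it is \<open>p n (y + 1)\<close>. Letting the summation bound \<open>N\<close> be any number from \<open>n\<close> on keeps it
  fixed in the induction, so that the index shifts produce only vanishing boundary terms.
\<close>

lemma P_power_row_0:
  assumes "n \<le> N"
  shows "P_power n 0 = (\<lambda>j. \<Sum>k\<le>N. laguerre_coeff n k * pascal k j)"
  using assms
proof (induction n)
  case 0
  have "(\<Sum>k\<le>N. laguerre_coeff 0 k * pascal k j) = (\<Sum>k\<in>{0}. laguerre_coeff 0 k * pascal k j)" for j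
    by (rule sum.mono_neutral_right) (auto simp: laguerre_coeff_eq_0)
  then show ?case
    by (auto simp: unit_matrix_def laguerre_coeff_def pascal_def monom_0 one_pCons[symmetric] fun_eq_iff)
next
  case (Suc n)
  let ?L = "laguerre_coeff n"
  from Suc have IH: "P_power n 0 = (\<lambda>j. \<Sum>k\<le>N. ?L k * pascal k j)" by simp
  have up: "(\<Sum>k\<le>N. ?L k * pascal (Suc k) j) =
      (\<Sum>k\<le>N. of_bool (k > 0) * ?L (k - 1) * pascal k j)" for j
  proof -
    have "(\<Sum>k\<le>Suc N. of_bool (k > 0) * ?L (k - 1) * pascal k j) = (\<Sum>k\<le>N. ?L k * pascal (Suc k) j)"
      by (subst sum.atMost_Suc_shift) simp
    then show ?thesis
      using Suc.prems by (simp add: laguerre_coeff_eq_0)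
  qed
  have down: "(\<Sum>k\<le>N. of_nat (k\<^sup>2) * q_var\<^sup>2 * ?L k * pascal (k - 1) j) =
      (\<Sum>k\<le>N. of_nat ((Suc k)\<^sup>2) * q_var\<^sup>2 * ?L (Suc k) * pascal k j)" for j
  proof -
    have "(\<Sum>k\<le>Suc N. of_nat (k\<^sup>2) * q_var\<^sup>2 * ?L k * pascal (k - 1) j) =
        (\<Sum>k\<le>N. of_nat ((Suc k)\<^sup>2) * q_var\<^sup>2 * ?L (Suc k) * pascal k j)"
      by (subst sum.atMost_Suc_shift) simp
    then show ?thesis
      using Suc.prems by (simp add: laguerre_coeff_eq_0)
  qed
  have "P_power (Suc n) 0 j = (\<Sum>k\<le>N. laguerre_coeff (Suc n) k * pascal k j)" for j
  proof -
    have "P_power (Suc n) 0 j = (\<Sum>k\<le>N. ?L k * right_A (right_X (right_A pascal)) k j)"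
      unfolding P_power.simps
      by (rule fun_cong[OF right_A_sum], rule right_X_sum, rule right_A_sum, rule IH)
    also have "\<dots> = (\<Sum>k\<le>N. ?L k * pascal (Suc k) j)
        + (\<Sum>k\<le>N. of_nat (2 * k + 1) * q_var * ?L k * pascal k j)
        + (\<Sum>k\<le>N. of_nat (k\<^sup>2) * q_var\<^sup>2 * ?L k * pascal (k - 1) j)"
      unfolding P_action_on_pascal sum.distrib[symmetric]
      by (rule sum.cong) (simp_all only: distrib_left mult.assoc mult.left_commute)
    also have "\<dots> = (\<Sum>k\<le>N. laguerre_coeff (Suc n) k * pascal k j)"
      unfolding up down laguerre_coeff_Suc sum.distrib[symmetric]
      by (simp only: distrib_right)
    finally show ?thesis .
  qed
  then show ?case
    by blast
qed

lemma rook_square_eq_P_power: "rook_square n = P_power n 0 0"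
proof -
  have "P_power n 0 0 = (\<Sum>k\<le>n. laguerre_coeff n k)"
    by (simp add: P_power_row_0[of n n] pascal_def)
  also have "\<dots> = (\<Sum>k\<le>n. laguerre_coeff n (n - k))"
    by (rule sum.reindex_bij_witness[of _ "\<lambda>k. n - k" "\<lambda>k. n - k"]) auto
  also have "\<dots> = rook_square n"
    unfolding rook_square_def atMost_atLeast0
  proof (rule sum.cong)
    fix k assume k: "k \<in> {0..n}"
    then have "real (n choose k) = fact n / (fact k * fact (n - k))"
      by (simp add: binomial_fact)
    then have "real (n choose (n - k)) * fact n / fact (n - k) = real ((n choose k)\<^sup>2 * fact k)"
      using k by (simp add: binomial_symmetric[symmetric] power2_eq_square)
    then show "laguerre_coeff n (n - k) = monom (of_nat ((n choose k)\<^sup>2 * fact k)) k"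
      using k by (simp add: laguerre_coeff_def)
  qed simp
  finally show ?thesis ..
qed

section \<open>From the unit matrix to the Hankel matrix\<close>

text \<open>
  The rows are \<open>e 0, e 0 P, ..., e 0 P^t, e 1 P^t, e 2 P^t, ...\<close>. For \<open>t = 0\<close> this is the unit
  matrix, and the first \<open>t + 1\<close> rows are already those of \<open>O\<close>.
\<close>

definition left_stage :: "nat \<Rightarrow> nat \<Rightarrow> nat \<Rightarrow> real poly" where
  "left_stage t i = (if i \<le> t then P_power i 0 else P_power t (i - t))"

text \<open>
  To pass to the next stage, row \<open>t\<close> has to stay, while the rows from \<open>t\<close> on, multiplied by
  \<open>P = A X A\<close>, have to appear one place lower. The first product with \<open>A\<close> leaves row \<open>t\<close> alone since
  \<open>e 0 A = e 0\<close>. In the product with \<open>X\<close>, row \<open>k\<close> becomes the sum of rows \<open>k\<close> and \<open>k + 1\<close>; stored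
  one place lower, each row thus gets its predecessor added, which is a bidiagonal operation that
  keeps row \<open>t\<close>. The second \<open>A\<close> acts on the rows below \<open>t\<close> only.
\<close>

lemma q_totally_positive_left_stage: "q_totally_positive (left_stage t)"
proof (induction t)
  case 0
  have "left_stage 0 = unit_matrix"
    by (auto simp: left_stage_def fun_eq_iff)
  then show ?case
    by (simp add: q_totally_positive_unit_matrix)
next
  case (Suc t)
  define M1 where "M1 i j = 1 * left_stage t i j + of_nat (i - t) * q_var * left_stage t (i - 1) j" for i j
  define M2 where "M2 i j = 1 * M1 i j + of_bool (t < i) * M1 (i - 1) j" for i j
  define M3 where "M3 i j = 1 * M2 i j + of_nat (i - Suc t) * q_var * M2 (i - 1) j" for i j
  have "q_totally_positive M1"
    unfolding M1_def
    by (rule q_totally_positive_add_previous_row[OF Suc.IH q_nonneg_1 q_nonneg_of_nat_q_var])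
  then have "q_totally_positive M2"
    unfolding M2_def
    by (rule q_totally_positive_add_previous_row[OF _ q_nonneg_1]) (simp add: q_nonneg_0 q_nonneg_1)
  then have M3: "q_totally_positive M3"
    unfolding M3_def
    by (rule q_totally_positive_add_previous_row[OF _ q_nonneg_1 q_nonneg_of_nat_q_var])
  have M1_le: "M1 i j = P_power i 0 j" if "i \<le> t" for i j
    using that by (simp add: M1_def left_stage_def)
  have M1: "M1 (t + k) j = left_A (P_power t) k j" for k j
    by (cases k) (auto simp: M1_def left_A_def left_stage_def)
  have M2_le: "M2 i j = P_power i 0 j" if "i \<le> t" for i j
    using that by (simp add: M2_def M1_le)
  have M2: "M2 (Suc (t + k)) j = left_X (left_A (P_power t)) k j" for k j
    using M1[of "Suc k" j] by (simp add: M2_def left_X_def M1)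
  have M3_le: "M3 i j = P_power i 0 j" if "i \<le> t" for i j
    using that by (simp add: M3_def M2_le)
  have M3_gt: "M3 (Suc (t + k)) j = P_power (Suc t) k j" for k j
    by (cases k) (use M2[of 0] M2[of k] in \<open>auto simp: M3_def M2 left_A_def P_power_Suc_left simp del: P_power.simps\<close>)
  have "M3 = left_stage (Suc t)"
  proof (intro ext)
    fix i j
    show "M3 i j = left_stage (Suc t) i j"
    proof (cases "i \<le> t")
      case False
      then have i: "i = Suc (t + (i - Suc t))" by simp
      show ?thesis
        using False
        by (subst i, subst M3_gt) (auto simp: left_stage_def le_Suc_eq simp del: P_power.simps)
    qed (simp add: M3_le left_stage_def)
  qed
  with M3 show ?case by simp
qed

text \<open>
  The first \<open>t + 1\<close> columns are those of the Hankel matrix, and the columns from \<open>t\<close> on form the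
  matrix \<open>O P^t\<close>. Both descriptions apply to column \<open>t\<close>. For \<open>t = 0\<close> this is \<open>O\<close>.
\<close>

definition right_stage :: "nat \<Rightarrow> nat \<Rightarrow> nat \<Rightarrow> real poly" where
  "right_stage t i j = (if j \<le> t then P_power (i + j) 0 0 else P_power (i + t) 0 (j - t))"

text \<open>
  For \<open>t = 0\<close>, a given minor of \<open>O\<close> is also a minor of \<open>left_stage\<close> at any stage beyond its rows.
  In the step, column \<open>t\<close> has to stay and the columns from \<open>t\<close> on, multiplied by \<open>A X A\<close>, have to
  appear one place further right. Here the shift is made by the first \<open>A\<close>: column \<open>k\<close> of \<open>M A\<close>
  combines columns \<open>k\<close> and \<open>k + 1\<close> of \<open>M\<close>, so stored at place \<open>k + 1\<close> it combines a column with its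
  predecessor. The products with \<open>X\<close> and with the second \<open>A\<close> then affect the columns beyond \<open>t\<close> only.
\<close>

lemma q_totally_positive_right_stage: "q_totally_positive (right_stage t)"
proof (induction t)
  case 0
  show ?case
    unfolding q_totally_positive_def
  proof (intro allI impI)
    fix m :: nat and r c :: "nat \<Rightarrow> nat"
    assume "strict_mono_on {..<m} r" "strict_mono_on {..<m} c"
    \<comment> \<open>The sum is merely a convenient upper bound for the row indices.\<close>
    then have "q_nonneg (minor (left_stage (\<Sum>i<m. r i)) m r c)"
      using q_totally_positive_left_stage by (auto simp: q_totally_positive_def)
    also have "minor (left_stage (\<Sum>i<m. r i)) m r c = minor (right_stage 0) m r c"
      by (rule minor_cong) (auto simp: left_stage_def right_stage_def member_le_sum)
    finally show "q_nonneg (minor (right_stage 0) m r c)" .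
  qed
next
  case (Suc t)
  define a where "a j = (if j \<le> t then 1 else of_nat (j - t) * q_var)" for j
  define M1 where "M1 i j = a j * right_stage t i j + of_bool (t < j) * right_stage t i (j - 1)" for i j
  define M2 where "M2 i j = 1 * M1 i j + of_bool (Suc t < j) * M1 i (j - 1)" for i j
  define M3 where "M3 i j = 1 * M2 i j + of_nat (j - t) * q_var * M2 i (Suc j)" for i j
  have "q_totally_positive M1"
    unfolding M1_def
    by (rule q_totally_positive_add_previous_column[OF Suc.IH])
      (auto simp: a_def q_nonneg_0 q_nonneg_1 q_nonneg_of_nat_q_var simp del: of_nat_diff)
  then have "q_totally_positive M2"
    unfolding M2_def
    by (rule q_totally_positive_add_previous_column[OF _ q_nonneg_1]) (simp add: q_nonneg_0 q_nonneg_1)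
  then have M3: "q_totally_positive M3"
    unfolding M3_def
    by (rule q_totally_positive_add_next_column[OF _ q_nonneg_1 q_nonneg_of_nat_q_var])
  have M1_le: "M1 i j = P_power (i + j) 0 0" if "j \<le> t" for i j
    using that by (simp add: M1_def a_def right_stage_def)
  have M1: "M1 i (Suc (t + k)) = right_A (P_power (i + t)) 0 k" for i k
    by (cases k) (auto simp: M1_def a_def right_A_def right_stage_def)
  have M2_le: "M2 i j = P_power (i + j) 0 0" if "j \<le> t" for i j
    using that by (simp add: M2_def M1_le)
  have M2: "M2 i (Suc (t + k)) = right_X (right_A (P_power (i + t))) 0 k" for i k
    by (cases k) (use M1[of i 0] M1[of i k] in \<open>auto simp: M2_def right_X_def M1\<close>)
  have M3_le: "M3 i j = P_power (i + j) 0 0" if "j \<le> t" for i j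
    using that by (simp add: M3_def M2_le)
  have M3_gt: "M3 i (Suc (t + k)) = P_power (i + Suc t) 0 k" for i k
    using M2[of i "Suc k"] by (simp add: M3_def M2 right_A_def[of _ 0 k])
  have "M3 = right_stage (Suc t)"
  proof (intro ext)
    fix i j
    show "M3 i j = right_stage (Suc t) i j"
    proof (cases "j \<le> t")
      case False
      then have j: "j = Suc (t + (j - Suc t))" by simp
      show ?thesis
        using False
        by (subst j, subst M3_gt) (auto simp: right_stage_def le_Suc_eq simp del: P_power.simps)
    qed (simp add: M3_le right_stage_def)
  qed
  with M3 show ?case by simp
qed

theorem proposition4p13:
  shows "q_stieltjes_moment rook_square"
  unfolding q_stieltjes_moment_def q_totally_positive_def
proof (intro allI impI)
  fix m :: nat and r c :: "nat \<Rightarrow> nat"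
  assume "strict_mono_on {..<m} r" "strict_mono_on {..<m} c"
  \<comment> \<open>The sum is an upper bound for the column indices, so all columns used are Hankel columns.\<close>
  then have "q_nonneg (minor (right_stage (\<Sum>j<m. c j)) m r c)"
    using q_totally_positive_right_stage by (auto simp: q_totally_positive_def)
  also have "minor (right_stage (\<Sum>j<m. c j)) m r c = minor (hankel rook_square) m r c"
    by (rule minor_cong)
      (auto simp: right_stage_def hankel_def rook_square_eq_P_power member_le_sum)
  finally show "q_nonneg (minor (hankel rook_square) m r c)" .
qed

end
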